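(* For every positive integer $n$, there is a neighborly family of $n$ congruent convex $3$-polytopes in $\mathbb{R}^3$.
   Context: A convex $d$-polytope is a bounded intersection of finitely many closed halfspaces in $\mathbb{R}^d$ that has nonempty interior (equivalently, the convex hull of a finite point set, of dimension $d$). A family of $d$-dimensional convex polytopes in $\mathbb{R}^d$ is neighborly if every two distinct members of the family have a $(d-1)$-dimensional intersection. Polytopes are congruent if each is the image of any other under an isometry of $\mathbb{R}^d$. *)

theory Defs
  imports "HOL-Analysis.Analysis"
begin

definition full_dim_polytope :: "'a::euclidean_space set \<Rightarrow> bool" where
  "full_dim_polytope P \<longleftrightarrow> polytope P \<and> interior P \<noteq> {}"

text \<open>The intersection of two members is convex, so its dimension is the dimension of its
  affine hull. The empty intersection has \<open>aff_dim\<close> equal to \<open>-1\<close>.\<close>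

definition neighborly :: "'a::euclidean_space set set \<Rightarrow> bool" where
  "neighborly F \<longleftrightarrow>
     (\<forall>P\<in>F. full_dim_polytope P) \<and>
     (\<forall>P\<in>F. \<forall>Q\<in>F. P \<noteq> Q \<longrightarrow> aff_dim (P \<inter> Q) = int DIM('a) - 1)"

text \<open>Isometries may reverse orientation, so mirror images count as congruent.\<close>

definition isometry_of_space :: "('a::euclidean_space \<Rightarrow> 'a) \<Rightarrow> bool" where
  "isometry_of_space f \<longleftrightarrow> surj f \<and> (\<forall>x y. dist (f x) (f y) = dist x y)"

definition congruent_sets :: "'a::euclidean_space set \<Rightarrow> 'a set \<Rightarrow> bool" where
  "congruent_sets P Q \<longleftrightarrow> (\<exists>f. isometry_of_space f \<and> f ` P = Q)"

end

theory Submission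
  imports Defs
begin

text \<open>After Erickson and Kim: take Voronoi cells of equally spaced points on a helix. For two points
  of the helix less than one turn apart there is a sphere through both that leaves every other nearby
  point of the helix strictly outside; its centre therefore lies in the relative interior of a common
  facet of the two cells. A screw motion permutes the points, so the cells are congruent. To stay
  finite, the cell of a point is only cut out by the bisectors with its \<open>n\<close> neighbours on either
  side and by a large box; the other cells are its images under the screw motion, box
  included.\<close>

section \<open>One-variable inequalities for sine and cosine\<close>

text \<open>This is strict decrease of sin z / z on (0, pi). The numerator z cos z - sin z of its
  derivative is negative, since it vanishes at 0 and has derivative -z sin z.\<close>

lemma mult_sin_less_mult_sin:
  fixes x y :: real
  assumes "0 < x" "x < y" "y < pi"
  shows "x * sin y < y * sin x"
proof -
  have deriv_neg: "z * cos z < sin z" if "0 < z" "z < pi" for z :: real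
  proof -
    have "z * cos z - sin z < 0 * cos 0 - sin 0"
    proof (rule DERIV_neg_imp_decreasing_open[where f = "\<lambda>z. z * cos z - sin z"])
      fix w assume "0 < w" "w < z"
      then have "((\<lambda>z. z * cos z - sin z) has_real_derivative - (w * sin w)) (at w) \<and> - (w * sin w) < 0"
        using that by (auto intro!: derivative_eq_intros mult_pos_pos sin_gt_zero)
      then show "\<exists>D. ((\<lambda>z. z * cos z - sin z) has_real_derivative D) (at w) \<and> D < 0" by blast
    qed (use that in \<open>auto intro!: continuous_intros\<close>)
    then show ?thesis by simp
  qed
  have "sin y / y < sin x / x"
  proof (rule DERIV_neg_imp_decreasing_open[where f = "\<lambda>z. sin z / z"])
    fix z assume "x < z" "z < y"
    then have "((\<lambda>z. sin z / z) has_real_derivative (cos z * z - sin z) / (z * z)) (at z) \<and>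
        (cos z * z - sin z) / (z * z) < 0"
      using assms deriv_neg[of z]
      by (auto intro!: derivative_eq_intros divide_neg_pos simp: mult.commute)
    then show "\<exists>D. ((\<lambda>z. sin z / z) has_real_derivative D) (at z) \<and> D < 0" by blast
  qed (use assms in \<open>auto intro!: continuous_intros\<close>)
  then show ?thesis using assms by (simp add: field_simps)
qed

text \<open>The function is an even double well with its minima at r and -r. The factor r / sin r
  makes its derivative at v a positive multiple of v sin r - r sin v, which by the previous lemma is
  negative on (0, r) and positive on (r, pi).\<close>

lemma square_plus_cos_strict_minimum:
  fixes r u :: real
  assumes r: "0 < r" "r < pi" and u: "\<bar>u\<bar> < pi" "\<bar>u\<bar> \<noteq> r"
  shows "r\<^sup>2 + 2 * (r / sin r) * cos r < u\<^sup>2 + 2 * (r / sin r) * cos u"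
proof -
  define G where "G v = v\<^sup>2 + 2 * (r / sin r) * cos v" for v
  have sr: "sin r > 0" using r by (rule sin_gt_zero)
  have G': "(G has_real_derivative 2 * ((v * sin r - r * sin v) / sin r)) (at v)" for v
    unfolding G_def using sr by (auto intro!: derivative_eq_intros simp: field_simps)
  have cont: "continuous_on A G" for A
    unfolding G_def by (intro continuous_intros)
  have "G r < G \<bar>u\<bar>"
  proof (cases "\<bar>u\<bar> < r")
    case True
    show ?thesis
    proof (rule DERIV_neg_imp_decreasing_open[OF True _ cont])
      fix v assume "\<bar>u\<bar> < v" "v < r"
      then have "2 * ((v * sin r - r * sin v) / sin r) < 0"
        using mult_sin_less_mult_sin[of v r] r sr by (simp add: divide_less_0_iff)
      then show "\<exists>D. (G has_real_derivative D) (at v) \<and> D < 0" using G' by blast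
    qed
  next
    case False
    then have "r < \<bar>u\<bar>" using u by simp
    then show ?thesis
    proof (rule DERIV_pos_imp_increasing_open[OF _ _ cont])
      fix v assume "r < v" "v < \<bar>u\<bar>"
      then have "2 * ((v * sin r - r * sin v) / sin r) > 0"
        using mult_sin_less_mult_sin[of r v] r u sr by (simp add: mult.commute)
      then show "\<exists>D. (G has_real_derivative D) (at v) \<and> D > 0" using G' by blast
    qed
  qed
  then show ?thesis by (simp add: G_def)
qed

section \<open>Screw motions and spheres touching the helix twice\<close>

text \<open>A rotation about the third axis combined with a rise along it. Angle and rise are the
  same t, so \<open>helix\<close> is the orbit of the point (1, 0, 0).\<close>

definition screw :: "real \<Rightarrow> real ^ 3 \<Rightarrow> real ^ 3" where
  "screw t x = vector [cos t * x $ 1 - sin t * x $ 2, sin t * x $ 1 + cos t * x $ 2, x $ 3 + t]"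

definition helix :: "real \<Rightarrow> real ^ 3" where
  "helix t = vector [cos t, sin t, t]"

lemma screw_screw: "screw s (screw t x) = screw (s + t) x"
  by (simp add: screw_def vec_eq_iff forall_3 sin_add cos_add algebra_simps)

lemma screw_0: "screw 0 x = x"
  by (simp add: screw_def vec_eq_iff forall_3)

lemma screw_helix: "screw s (helix t) = helix (s + t)"
  by (simp add: screw_def helix_def vec_eq_iff forall_3 sin_add cos_add algebra_simps)

lemma dist_vec3_power2:
  fixes x y :: "real ^ 3"
  shows "(dist x y)\<^sup>2 = (x $ 1 - y $ 1)\<^sup>2 + (x $ 2 - y $ 2)\<^sup>2 + (x $ 3 - y $ 3)\<^sup>2"
  unfolding dist_norm power2_norm_eq_inner
  by (simp add: inner_vec_def sum_3 power2_eq_square)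

lemma dist_screw: "dist (screw t x) (screw t y) = dist x y"
proof -
  define a where "a = x $ 1 - y $ 1"
  define b where "b = x $ 2 - y $ 2"
  have "(dist (screw t x) (screw t y))\<^sup>2 =
      (cos t * a - sin t * b)\<^sup>2 + (sin t * a + cos t * b)\<^sup>2 + (x $ 3 - y $ 3)\<^sup>2"
    by (simp add: dist_vec3_power2 screw_def a_def b_def algebra_simps)
  also have "\<dots> = ((sin t)\<^sup>2 + (cos t)\<^sup>2) * (a\<^sup>2 + b\<^sup>2) + (x $ 3 - y $ 3)\<^sup>2"
    by algebra
  also have "\<dots> = (dist x y)\<^sup>2"
    by (simp add: dist_vec3_power2 a_def b_def)
  finally show ?thesis by simp
qed

text \<open>As a function of the parameter, the squared distance from the centre is, up to a
  constant, the double well of \<open>square_plus_cos_strict_minimum\<close> shifted to the midpoint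
  of a and b. Its two minima are the end points.\<close>

lemma helix_bitangent_sphere:
  fixes a b :: real
  assumes "a < b" "b - a < 2 * pi"
  obtains c where "dist c (helix a) = dist c (helix b)"
    and "\<And>t. \<lbrakk>\<bar>t - (a + b) / 2\<bar> < pi; t \<noteq> a; t \<noteq> b\<rbrakk> \<Longrightarrow> dist c (helix a) < dist c (helix t)"
proof -
  define s where "s = (a + b) / 2"
  define r where "r = (b - a) / 2"
  define q where "q = r / sin r"
  \<comment> \<open>By symmetry the centre lies on the horizontal line through the axis and the midpoint of the arc;
    \<open>q\<close> makes the squared distance stationary at both end points.\<close>
  define c where "c = screw s (vector [- q, 0, 0])"
  have r: "0 < r" "r < pi" using assms by (auto simp: r_def)
  have ab: "a = s - r" "b = s + r" by (simp_all add: s_def r_def field_simps)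
  have D: "(dist c (helix t))\<^sup>2 = 1 + q\<^sup>2 + ((t - s)\<^sup>2 + 2 * q * cos (t - s))" for t
  proof -
    \<comment> \<open>Undoing the screw motion by \<open>s\<close> moves the midpoint of the arc to
      parameter 0.\<close>
    have "(dist c (helix t))\<^sup>2 = (dist (vector [- q, 0, 0]) (helix (t - s)))\<^sup>2"
      using dist_screw[of s _ "helix (t - s)"] by (simp add: c_def screw_helix)
    also have "(dist (vector [- q, 0, 0]) (helix (t - s)))\<^sup>2 = (q + cos (t - s))\<^sup>2 + (sin (t - s))\<^sup>2 + (t - s)\<^sup>2"
      unfolding dist_vec3_power2 helix_def vector_3 by (simp add: power2_eq_square algebra_simps)
    also have "\<dots> = ((sin (t - s))\<^sup>2 + (cos (t - s))\<^sup>2) + q\<^sup>2 + ((t - s)\<^sup>2 + 2 * q * cos (t - s))"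
      by (simp add: power2_sum)
    finally show ?thesis by simp
  qed
  show thesis
  proof
    have "(dist c (helix a))\<^sup>2 = (dist c (helix b))\<^sup>2" by (simp add: D ab)
    then show "dist c (helix a) = dist c (helix b)" by simp
    fix t assume t: "\<bar>t - (a + b) / 2\<bar> < pi" "t \<noteq> a" "t \<noteq> b"
    have "(dist c (helix a))\<^sup>2 < (dist c (helix t))\<^sup>2"
      using square_plus_cos_strict_minimum[OF r, of "t - s"] t
      by (auto simp: D ab q_def abs_if split: if_splits)
    then show "dist c (helix a) < dist c (helix t)"
      by (rule power2_less_imp_less) simp
  qed
qed

section \<open>Bisectors and isometric images of polytopes\<close>

text \<open>The quadratic term in x cancels when the squared distances are compared. The linear form
  lets the library facts on halfspaces apply to Voronoi conditions.\<close>

lemma dist_le_dist_iff_halfspace: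
  fixes x a b :: "'a::real_inner"
  shows "dist x a \<le> dist x b \<longleftrightarrow> (2 *\<^sub>R (b - a)) \<bullet> x \<le> b \<bullet> b - a \<bullet> a"
  by (simp add: dist_norm norm_le inner_commute algebra_simps)

lemma dist_eq_dist_iff_hyperplane:
  fixes x a b :: "'a::real_inner"
  shows "dist x a = dist x b \<longleftrightarrow> (2 *\<^sub>R (b - a)) \<bullet> x = b \<bullet> b - a \<bullet> a"
  by (simp add: dist_norm norm_eq inner_commute algebra_simps)

text \<open>Subtracting the value at 0 leaves an isometry that fixes the origin, hence an orthogonal
  transformation.\<close>

lemma isometry_affine:
  fixes f :: "'a::euclidean_space \<Rightarrow> 'a"
  assumes "\<And>x y. dist (f x) (f y) = dist x y"
  obtains g where "linear g" "bij g" "f = (\<lambda>x. f 0 + g x)"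
proof -
  define g where "g x = f x - f 0" for x
  have "orthogonal_transformation g"
    unfolding orthogonal_transformation_isometry
    using assms by (simp add: g_def dist_norm)
  then show thesis
    using that[of g] by (auto simp: g_def orthogonal_transformation_linear orthogonal_transformation_bij)
qed

lemma full_dim_polytope_isometry_image:
  fixes f :: "'a::euclidean_space \<Rightarrow> 'a"
  assumes "\<And>x y. dist (f x) (f y) = dist x y" and P: "full_dim_polytope P"
  shows "full_dim_polytope (f ` P)"
proof -
  obtain g where g: "linear g" "bij g" "f = (\<lambda>x. f 0 + g x)"
    using isometry_affine[OF assms(1)] by blast
  have eq: "f ` P = (+) (f 0) ` g ` P"
    by (subst g(3)) (simp add: image_image)
  show ?thesis
    unfolding full_dim_polytope_def eq interior_translation interior_bijective_linear_image[OF g(1,2)]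
    using P g(1) by (simp add: full_dim_polytope_def polytope_linear_image polytope_translation_eq)
qed

section \<open>From touching spheres to a neighborly family of cells\<close>

text \<open>Separates the polyhedral argument from the helix. For 0 \<le> i < n the neighbours that
  cut out cell i have indices from -n to 2n - 1, so the range in \<open>sphere\<close> covers every
  bisector used by cell i or cell j.\<close>

lemma neighborly_family_of_orbit:
  fixes S :: "int \<Rightarrow> 'a::euclidean_space \<Rightarrow> 'a" and p :: "int \<Rightarrow> 'a" and n :: nat
  assumes S_dist: "\<And>i x y. dist (S i x) (S i y) = dist x y"
    and S_0: "\<And>x. S 0 x = x"
    and S_add: "\<And>i j x. S i (S j x) = S (i + j) x"
    and S_p: "\<And>i j. S i (p j) = p (i + j)"
    and "inj p"
    and sphere: "\<And>i j. \<lbrakk>0 \<le> i; i < j; j < int n\<rbrakk> \<Longrightarrow>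
      \<exists>c. dist c (p i) = dist c (p j) \<and>
        (\<forall>k\<in>{- int n..2 * int n} - {i, j}. dist c (p i) < dist c (p k))"
  shows "\<exists>F :: 'a set set. finite F \<and> card F = n \<and> neighborly F \<and>
           (\<forall>P\<in>F. \<forall>Q\<in>F. congruent_sets P Q)"
proof -
  obtain c where c: "\<And>i j. \<lbrakk>0 \<le> i; i < j; j < int n\<rbrakk> \<Longrightarrow> dist (c i j) (p i) = dist (c i j) (p j)"
    "\<And>i j k. \<lbrakk>0 \<le> i; i < j; j < int n; k \<in> {- int n..2 * int n} - {i, j}\<rbrakk> \<Longrightarrow>
      dist (c i j) (p i) < dist (c i j) (p k)"
    using sphere by metis
  define I where "I = {0..<int n}"
  \<comment> \<open>The box must contain each centre after it is pulled back from cell i or cell j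
    to the cell of \<open>p 0\<close>. Letting \<open>l\<close> run over all of \<open>I\<close>
    covers both cases. For i \<ge> j the values of \<open>c\<close> are arbitrary, which can only
    enlarge the box.\<close>
  have "finite (insert (p 0) (\<Union>i\<in>I. \<Union>j\<in>I. \<Union>l\<in>I. {S (- l) (c i j)}))"
    by (simp add: I_def)
  from bounded_subset_box_symmetric[OF finite_imp_bounded[OF this]]
  obtain a where sub: "insert (p 0) (\<Union>i\<in>I. \<Union>j\<in>I. \<Union>l\<in>I. {S (- l) (c i j)}) \<subseteq> box (- a) a" .
  have a: "p 0 \<in> box (- a) a"
    "\<And>i j l. \<lbrakk>i \<in> I; j \<in> I; l \<in> I\<rbrakk> \<Longrightarrow> S (- l) (c i j) \<in> box (- a) a"
    using sub by blast+
  define P\<^sub>0 where "P\<^sub>0 = cbox (- a) a \<inter> (\<Inter>k\<in>{- int n..int n}. {x. dist x (p 0) \<le> dist x (p k)})"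
  define P where "P i = S i ` P\<^sub>0" for i
  have S_inverse: "S (- i) (S i x) = x" "S i (S (- i) x) = x" for i x
    by (simp_all add: S_add S_0)
  have isometry: "isometry_of_space (S i)" for i
    unfolding isometry_of_space_def surj_def using S_dist S_inverse by metis
  have S_open: "open (S i -` U)" if "open U" for i U
  proof -
    have "continuous_on UNIV (S i)"
      unfolding continuous_on_iff S_dist by auto
    then show ?thesis using that by (simp add: open_vimage)
  qed
  have dist_S: "dist (S (- i) x) (p k) = dist x (p (i + k))" for i x k
    using S_dist[of i "S (- i) x" "p k"] by (simp add: S_inverse S_p)
  have mem_P: "x \<in> P i \<longleftrightarrow> S (- i) x \<in> cbox (- a) a \<and>
      (\<forall>k\<in>{- int n..int n}. dist x (p i) \<le> dist x (p (i + k)))" for x i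
  proof -
    have "x \<in> P i \<longleftrightarrow> S (- i) x \<in> P\<^sub>0"
      unfolding P_def using S_inverse by (metis image_iff)
    then show ?thesis
      by (simp add: P\<^sub>0_def dist_S)
  qed
  have open_closer: "open {x. dist x u < dist x v}" for u v :: 'a
    by (intro open_Collect_less continuous_intros)
  have "full_dim_polytope P\<^sub>0"
    unfolding full_dim_polytope_def
  proof
    show "polytope P\<^sub>0"
      unfolding P\<^sub>0_def dist_le_dist_iff_halfspace
      by (intro polytope_Int_polyhedron polytope_interval polyhedron_Inter)
        (auto intro: polyhedron_halfspace_le simp del: inner_scaleR_left)
    \<comment> \<open>A neighbourhood of \<open>p 0\<close> inside the cell. The index 0 is left out
      because its strict inequality would be false.\<close>
    define U where "U = box (- a) a \<inter>
      (\<Inter>k\<in>{- int n..int n} - {0}. {x. dist x (p 0) < dist x (p k)})"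
    have "open U"
      unfolding U_def by (intro open_Int open_INT ballI open_box open_closer) auto
    moreover have "U \<subseteq> P\<^sub>0"
    proof
      fix x assume x: "x \<in> U"
      have "dist x (p 0) \<le> dist x (p k)" if "k \<in> {- int n..int n}" for k
        using x that by (cases "k = 0") (auto simp: U_def intro: less_imp_le)
      then show "x \<in> P\<^sub>0"
        using x box_subset_cbox[of "- a" a] by (auto simp: U_def P\<^sub>0_def)
    qed
    moreover have "p 0 \<in> U"
      using a(1) \<open>inj p\<close> by (auto simp: U_def inj_eq)
    ultimately show "interior P\<^sub>0 \<noteq> {}"
      using interior_maximal by blast
  qed
  then have full_dim: "full_dim_polytope (P i)" for i
    unfolding P_def by (rule full_dim_polytope_isometry_image[OF S_dist])
  have facet: "aff_dim (P i \<inter> P j) = int DIM('a) - 1" if ij: "0 \<le> i" "i < j" "j < int n" for i j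
  proof -
    define H where "H = {x. dist x (p i) = dist x (p j)}"
    have H: "H = {x. (2 *\<^sub>R (p j - p i)) \<bullet> x = p j \<bullet> p j - p i \<bullet> p i}"
      by (simp add: H_def dist_eq_dist_iff_hyperplane)
    have "p i \<noteq> p j" using \<open>inj p\<close> ij by (simp add: inj_eq)
    then have dim_H: "aff_dim H = int DIM('a) - 1"
      unfolding H by (subst aff_dim_hyperplane) auto
    have "P i \<inter> P j \<subseteq> H"
    proof
      \<comment> \<open>The offsets j - i and i - j both lie between -n and n, so each cell is cut
        by its bisector with the other point.\<close>
      fix x assume "x \<in> P i \<inter> P j"
      then have "dist x (p i) \<le> dist x (p (i + (j - i)))" "dist x (p j) \<le> dist x (p (j + (i - j)))"
        using ij unfolding mem_P Int_iff by (fastforce, fastforce)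
      then show "x \<in> H" by (simp add: H_def)
    qed
    then have le: "aff_dim (P i \<inter> P j) \<le> int DIM('a) - 1"
      using aff_dim_subset dim_H by metis
    \<comment> \<open>Near the centre every condition except the bisector of \<open>p i\<close> and
      \<open>p j\<close> holds strictly. A relatively open piece of the hyperplane \<open>H\<close>
      therefore lies in both cells, and it has the full dimension of \<open>H\<close>.\<close>
    define U where "U = S (- i) -` box (- a) a \<inter> S (- j) -` box (- a) a \<inter>
      (\<Inter>k\<in>{- int n..2 * int n} - {i, j}. {x. dist x (p i) < dist x (p k)})"
    have "open U"
      unfolding U_def by (intro open_Int open_INT ballI S_open open_box open_closer) auto
    moreover have "c i j \<in> H \<inter> U"
      using c a(2) ij by (auto simp: H_def U_def I_def)
    moreover have "convex H"
      unfolding H by (rule convex_hyperplane)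
    ultimately have "aff_dim (H \<inter> U) = aff_dim H"
      by (intro aff_dim_convex_Int_open) auto
    moreover have "H \<inter> U \<subseteq> P i \<inter> P j"
    proof
      fix x assume x: "x \<in> H \<inter> U"
      then have eq: "dist x (p i) = dist x (p j)" by (simp add: H_def)
      have "dist x (p i) \<le> dist x (p k)" if "k \<in> {- int n..2 * int n}" for k
        using x that eq by (cases "k = i \<or> k = j") (auto simp: U_def intro: less_imp_le)
      then show "x \<in> P i \<inter> P j"
        using x ij eq box_subset_cbox[of "- a" a] by (auto simp: mem_P U_def)
    qed
    ultimately show ?thesis
      using le dim_H aff_dim_subset[of "H \<inter> U" "P i \<inter> P j"] by simp
  qed
  have facet': "aff_dim (P i \<inter> P j) = int DIM('a) - 1" if "i \<in> I" "j \<in> I" "i \<noteq> j" for i j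
    using facet[of i j] facet[of j i] that by (cases "i < j") (auto simp: I_def Int_commute)
  have "inj_on P I"
  proof (rule inj_onI, rule ccontr)
    fix i j assume ij: "i \<in> I" "j \<in> I" "P i = P j" "i \<noteq> j"
    \<comment> \<open>Equal cells would meet in a set of full dimension instead of a facet.\<close>
    then have "aff_dim (P i) = int DIM('a) - 1" using facet'[of i j] by simp
    moreover have "aff_dim (P i) = int DIM('a)"
      using full_dim[of i] by (simp add: full_dim_polytope_def aff_dim_nonempty_interior)
    ultimately show False by simp
  qed
  then have "card (P ` I) = n"
    by (simp add: card_image I_def)
  moreover have "neighborly (P ` I)"
    unfolding neighborly_def using full_dim facet' by blast
  moreover have "congruent_sets (P i) (P j)" for i j
    unfolding congruent_sets_def
  proof (intro exI conjI)
    show "isometry_of_space (S (j - i))" by (rule isometry)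
    show "S (j - i) ` P i = P j" by (simp add: P_def image_image S_add)
  qed
  ultimately show ?thesis
    by (intro exI[of _ "P ` I"]) (auto simp: I_def)
qed

section \<open>Equally spaced points on the helix\<close>

theorem mainTheorem1:
  fixes n :: nat
  assumes "n \<ge> 1"
  shows "\<exists>F :: (real ^ 3) set set.
           finite F \<and> card F = n \<and> neighborly F \<and>
           (\<forall>P\<in>F. \<forall>Q\<in>F. congruent_sets P Q)"
proof -
  \<comment> \<open>The spacing is small enough that all points compared lie well within one turn.\<close>
  define d where "d = 1 / (2 * real n)"
  have d: "d > 0" "2 * real n * d = 1" using assms by (auto simp: d_def)
  show ?thesis
  proof (rule neighborly_family_of_orbit[where S = "\<lambda>k. screw (k * d)" and p = "\<lambda>k. helix (k * d)"])
    fix i j :: int assume ij: "0 \<le> i" "i < j" "j < int n"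
    have close: "\<bar>real_of_int k * d - (real_of_int i * d + real_of_int j * d) / 2\<bar> < pi"
      if "k \<in> {- int n..2 * int n}" for k
    proof -
      \<comment> \<open>Twice k lies between -2n and 4n, and i + j between 0 and 2n. After scaling
        by \<open>d\<close> and halving, the parameter is at distance at most 1 from the
        midpoint.\<close>
      have "\<bar>2 * k - i - j\<bar> \<le> 4 * int n"
        using ij that unfolding atLeastAtMost_iff by linarith
      then have "real_of_int \<bar>2 * k - i - j\<bar> \<le> real_of_int (4 * int n)"
        by (simp only: of_int_le_iff)
      then have "\<bar>2 * real_of_int k - real_of_int i - real_of_int j\<bar> \<le> 4 * real n"
        by simp
      then have "\<bar>2 * real_of_int k - real_of_int i - real_of_int j\<bar> * d \<le> 4 * real n * d"
        using d by (intro mult_right_mono) auto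
      also have "\<dots> = 2" using d by linarith
      finally have "\<bar>(2 * real_of_int k - real_of_int i - real_of_int j) * d\<bar> \<le> 2"
        using d by (simp add: abs_mult)
      moreover have "real_of_int k * d - (real_of_int i * d + real_of_int j * d) / 2 =
          (2 * real_of_int k - real_of_int i - real_of_int j) * d / 2"
        by (simp add: field_simps)
      ultimately show ?thesis using pi_gt3 by linarith
    qed
    have "real_of_int j * d - real_of_int i * d < 2 * pi"
    proof -
      have "real_of_int j * d - real_of_int i * d = real_of_int (j - i) * d"
        by (simp add: algebra_simps)
      also have "\<dots> \<le> (2 * real n) * d"
        using ij d by (intro mult_right_mono) auto
      finally show ?thesis using d pi_gt3 by simp
    qed
    then obtain c where "dist c (helix (i * d)) = dist c (helix (j * d))"
      "\<And>t. \<lbrakk>\<bar>t - (i * d + j * d) / 2\<bar> < pi; t \<noteq> i * d; t \<noteq> j * d\<rbrakk> \<Longrightarrow>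
        dist c (helix (i * d)) < dist c (helix t)"
      using helix_bitangent_sphere[of "i * d" "j * d"] ij d by auto
    then show "\<exists>c. dist c (helix (i * d)) = dist c (helix (j * d)) \<and>
        (\<forall>k\<in>{- int n..2 * int n} - {i, j}. dist c (helix (i * d)) < dist c (helix (k * d)))"
      using close d by (intro exI[of _ c]) auto
  next
    show "inj (\<lambda>k :: int. helix (k * d))"
    proof (rule injI)
      fix k l :: int assume "helix (k * d) = helix (l * d)"
      then have "helix (k * d) $ 3 = helix (l * d) $ 3" by simp
      then show "k = l" using d by (simp add: helix_def)
    qed
  next
    fix i j :: int and x y
    show "dist (screw (i * d) x) (screw (i * d) y) = dist x y" by (rule dist_screw)
    show "screw (i * d) (screw (j * d) x) = screw (real_of_int (i + j) * d) x"
      by (simp add: screw_screw algebra_simps)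
    show "screw (i * d) (helix (j * d)) = helix (real_of_int (i + j) * d)"
      by (simp add: screw_helix algebra_simps)
    show "screw (real_of_int 0 * d) x = x" by (simp add: screw_0)
  qed
qed

end
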